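(* Let $K,L,Q\in\mathcal{S}_{c+}^n$, let $q\ne0$ be real, let $\varphi:(0,\infty)\to(0,\infty)$, and let $\varphi_q(t)=\varphi(t^{1/q})$ for $t\in(0,\infty)$. Suppose that $\varphi$ is either increasing or decreasing, and that $\varphi_q$ is either strictly convex or strictly concave. Then $K=L$ if either $$\frac{\widetilde{V}_{q,\varphi}(K,M,Q)}{\widetilde{V}_q(K,Q)}=\frac{\widetilde{V}_{q,\varphi}(L,M,Q)}{\widetilde{V}_q(L,Q)}$$ holds for all $M\in\mathcal{S}_{c+}^n$, or $$\widetilde{V}_{q,\varphi}(M,K,Q)=\widetilde{V}_{q,\varphi}(M,L,Q)$$ holds for all $M\in\mathcal{S}_{c+}^n$.
   Context: $\mathcal{S}_{c+}^n$ is the class of star bodies in $\mathbb{R}^n$: compact sets $L$ that are star-shaped about the origin and whose radial function $\rho_L(u)=\sup\{\lambda>0:\lambda u\in L\}$, $u\in S^{n-1}$, is positive and continuous on $S^{n-1}$ (so a star body is determined by its radial function). With $du=d\mathcal{H}^{n-1}(u)$ on $S^{n-1}$, define $$\widetilde{V}_q(K,Q)=\frac1n\int_{S^{n-1}}\rho_K(u)^q\rho_Q(u)^{n-q}\,du,$$ $$\widetilde{V}_{q,\varphi}(K,L,Q)=\frac1n\int_{S^{n-1}}\varphi\!\left(\frac{\rho_L(u)}{\rho_K(u)}\right)\rho_K(u)^q\rho_Q(u)^{n-q}\,du.$$ *)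

theory Defs
  imports "HOL-Analysis.Analysis"
begin

section \<open>Hausdorff measure\<close>

text \<open>Normalised so that in k-dimensional Euclidean space it agrees with Lebesgue measure.
  Nonempty sets of diameter 0 have weight 1 when \<open>k = 0\<close> (as \<open>0 ^ 0 = 1\<close>), so that
  the 0-dimensional measure is counting measure.\<close>

definition hausdorff_weight :: "nat \<Rightarrow> 'a::metric_space set \<Rightarrow> ennreal" where
  "hausdorff_weight k U =
     (if U = {} then 0 else ennreal (unit_ball_vol (real k) * (diameter U / 2) ^ k))"

text \<open>Boundedness of the covering sets is required separately, because \<^const>\<open>diameter\<close>
  is real-valued and meaningless on unbounded sets.\<close>

definition hausdorff_pre :: "nat \<Rightarrow> real \<Rightarrow> 'a::metric_space set \<Rightarrow> ennreal" where
  "hausdorff_pre k \<delta> A =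
     (INF U \<in> {U :: nat \<Rightarrow> 'a set. A \<subseteq> (\<Union>i. U i) \<and> (\<forall>i. bounded (U i) \<and> diameter (U i) \<le> \<delta>)}.
        (\<Sum>i. hausdorff_weight k (U i)))"

definition hausdorff_outer :: "nat \<Rightarrow> 'a::metric_space set \<Rightarrow> ennreal" where
  "hausdorff_outer k A = (SUP \<delta> \<in> {0<..}. hausdorff_pre k \<delta> A)"

text \<open>\<^const>\<open>hausdorff_outer\<close> is a metric outer measure, hence by Caratheodory's criterion
  countably additive on the Borel sets, as \<^const>\<open>measure_of\<close> needs.\<close>

definition hausdorff_measure :: "nat \<Rightarrow> 'a::metric_space measure" where
  "hausdorff_measure k = measure_of UNIV (sets borel) (hausdorff_outer k)"

section \<open>Star bodies\<close>

text \<open>The inserted 0 only fixes the convention that the supremum of the empty set is 0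
  (over the reals it would otherwise be unspecified).\<close>

definition radial_function :: "(real ^ 'n) set \<Rightarrow> real ^ 'n \<Rightarrow> real" where
  "radial_function L u = Sup (insert 0 {r. r > 0 \<and> r *\<^sub>R u \<in> L})"

definition star_body :: "(real ^ 'n) set \<Rightarrow> bool" where
  "star_body L \<longleftrightarrow>
     compact L \<and> (\<forall>x\<in>L. closed_segment 0 x \<subseteq> L) \<and>
     (\<forall>u\<in>sphere 0 1. radial_function L u > 0) \<and>
     continuous_on (sphere 0 1) (radial_function L)"

section \<open>Dual mixed volumes\<close>

definition dual_mixed_volume :: "real \<Rightarrow> (real ^ 'n) set \<Rightarrow> (real ^ 'n) set \<Rightarrow> real" where
  "dual_mixed_volume q K Q =
     1 / real CARD('n) *
     (LINT u:sphere 0 1|hausdorff_measure (CARD('n) - 1).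
        radial_function K u powr q * radial_function Q u powr (real CARD('n) - q))"

definition dual_Orlicz_mixed_volume ::
  "real \<Rightarrow> (real \<Rightarrow> real) \<Rightarrow> (real ^ 'n) set \<Rightarrow> (real ^ 'n) set \<Rightarrow> (real ^ 'n) set \<Rightarrow> real" where
  "dual_Orlicz_mixed_volume q \<phi> K L Q =
     1 / real CARD('n) *
     (LINT u:sphere 0 1|hausdorff_measure (CARD('n) - 1).
        \<phi> (radial_function L u / radial_function K u) *
        radial_function K u powr q * radial_function Q u powr (real CARD('n) - q))"

section \<open>Strict convexity\<close>

definition strictly_convex_on :: "real set \<Rightarrow> (real \<Rightarrow> real) \<Rightarrow> bool" where
  "strictly_convex_on S f \<longleftrightarrow> convex S \<and>
     (\<forall>x\<in>S. \<forall>y\<in>S. \<forall>t\<in>{0<..<1}. x \<noteq> y \<longrightarrow>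
        f ((1 - t) * x + t * y) < (1 - t) * f x + t * f y)"

definition strictly_concave_on :: "real set \<Rightarrow> (real \<Rightarrow> real) \<Rightarrow> bool" where
  "strictly_concave_on S f \<longleftrightarrow> strictly_convex_on S (\<lambda>x. - f x)"

end

theory Submission
  imports Defs
begin

text \<open>Taking \<open>M = K\<close> and \<open>M = L\<close> in either hypothesis and writing \<open>V\<close> for the dual mixed volume with
\<open>Q\<close> and \<open>W B C\<close> for the dual Orlicz mixed volume of \<open>B\<close>, \<open>C\<close> and \<open>Q\<close> gives the same two equations,
\<open>W L K = \<phi> 1 * V L\<close> and \<open>W K L = \<phi> 1 * V K\<close>. Put \<open>a = \<rho>\<^sub>K powr q * \<rho>\<^sub>Q powr (n - q)\<close> and
\<open>b = \<rho>\<^sub>L powr q * \<rho>\<^sub>Q powr (n - q)\<close>. Then \<open>n * W L K\<close> is the integral over the sphere of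
\<open>\<phi>\<^sub>q (a / b) * b\<close>, and symmetrically for \<open>W K L\<close>. If \<open>\<phi>\<^sub>q\<close> is strictly convex (otherwise pass to
\<open>- \<phi>\<^sub>q\<close>), it lies strictly above its supporting line at 1 except at 1. Integrating this inequality for
\<open>a / b\<close> against \<open>b\<close> and for \<open>b / a\<close> against \<open>a\<close>, the linear terms cancel in the sum, so equality holds
almost everywhere and \<open>a = b\<close>: this is the lemma \<open>f_divergence_equality\<close>. A star body is determined by
its radial function, hence \<open>K = L\<close>.

This uses of the surface measure that continuous functions are integrable and that a nonnegative
continuous function with integral 0 vanishes. For the Hausdorff measure of dimension \<open>n - 1\<close> that amounts
to three facts. It is a Borel measure, by Caratheodory's criterion for metric outer measures. It is
finite on the sphere, because volume packing in an annulus yields nets with few points. And it is positive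
on relatively open parts of the sphere, because coverings of such a part yield coverings of the cone over
it, whose Lebesgue measure is positive.\<close>

section \<open>Metric outer measures\<close>

text \<open>Caratheodory's criterion for metric outer measures. A closed set \<open>C\<close> splits every \<open>T\<close>
additively, because \<open>T - C\<close> is exhausted by its parts \<open>A n\<close> at distance at least
\<open>1 / (n + 1)\<close> from \<open>C\<close>. Each \<open>A n\<close> is separated from \<open>C\<close>, and what \<open>A n\<close> misses is a tail
of the shells \<open>R i\<close>, whose total mass is finite when \<open>f T\<close> is. So the closed sets lie in the
sigma-algebra of Caratheodory measurable sets, and with them all Borel sets.\<close>

lemma metric_outer_measure_caratheodory:
  fixes f :: "'a::metric_space set \<Rightarrow> ennreal"
  assumes empty: "f {} = 0"
    and mono: "\<And>A B. A \<subseteq> B \<Longrightarrow> f A \<le> f B"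
    and subadd: "\<And>A :: nat \<Rightarrow> 'a set. f (\<Union>i. A i) \<le> (\<Sum>i. f (A i))"
    and metric: "\<And>A B e. e > 0 \<Longrightarrow> (\<And>x y. x \<in> A \<Longrightarrow> y \<in> B \<Longrightarrow> e \<le> dist x y)
                   \<Longrightarrow> f A + f B \<le> f (A \<union> B)"
  shows "measure_space UNIV (sets borel) f"
proof -
  have subadd2: "f (A \<union> B) \<le> f A + f B" for A B
  proof -
    let ?A = "\<lambda>i::nat. if i = 0 then A else if i = 1 then B else {}"
    have "f (A \<union> B) = f (\<Union>i. ?A i)"
      by (rule arg_cong[of _ _ f]) (auto split: if_splits)
    also have "\<dots> \<le> (\<Sum>i. f (?A i))" by (rule subadd)
    also have "\<dots> = (\<Sum>i\<in>{0,1}. f (?A i))"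
      by (rule suminf_finite) (auto simp: empty)
    finally show ?thesis by simp
  qed
  have closed_split: "f (C \<inter> T) + f (T - C) \<le> f T" if C: "closed C" "C \<noteq> {}" for C T
  proof (cases "f T = \<infinity>")
    case False
    define d where "d x = infdist x C" for x
    have d_lip: "d x - d y \<le> dist x y" for x y
      unfolding d_def using infdist_triangle[of x C y] by linarith
    define r where "r n = inverse (real (Suc n))" for n
    have r_dec: "r m < r n" if "n < m" for m n
      using that by (simp add: r_def)
    have r_dec': "r m \<le> r n" if "n \<le> m" for m n
      using that by (simp add: r_def)
    have r_pos: "r n > 0" for n by (simp add: r_def)
    define A where "A n = {x \<in> T. r n \<le> d x}" for n
    define R where "R n = {x \<in> T. r (Suc n) \<le> d x \<and> d x < r n}" for n
    \<comment> \<open>Shells of the same parity are separated by a whole shell.\<close>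
    have parity: "(\<Sum>i<m. f (R (2 * i + j))) \<le> f (\<Union>i<m. R (2 * i + j))" for m j
    proof (induction m)
      case (Suc m)
      show ?case
      proof (cases m)
        case (Suc l)
        have "f (\<Union>i<m. R (2 * i + j)) + f (R (2 * m + j))
            \<le> f ((\<Union>i<m. R (2 * i + j)) \<union> R (2 * m + j))"
        proof (rule metric)
          show "0 < r (2 * l + j + 1) - r (2 * m + j)"
            using r_dec[of "2 * l + j + 1" "2 * m + j"] Suc by simp
        next
          fix x y assume x: "x \<in> (\<Union>i<m. R (2 * i + j))" and y: "y \<in> R (2 * m + j)"
          obtain i where i: "i < m" "x \<in> R (2 * i + j)" using x by blast
          have "r (2 * l + j + 1) \<le> r (Suc (2 * i + j))" using i Suc by (intro r_dec') simp
          also have "\<dots> \<le> d x" using i by (simp add: R_def)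
          finally have "r (2 * l + j + 1) \<le> d x" .
          moreover have "d y < r (2 * m + j)" using y by (simp add: R_def)
          ultimately show "r (2 * l + j + 1) - r (2 * m + j) \<le> dist x y"
            using d_lip[of x y] by linarith
        qed
        moreover have "(\<Union>i<Suc m. R (2 * i + j)) = (\<Union>i<m. R (2 * i + j)) \<union> R (2 * m + j)"
          by (auto simp: less_Suc_eq)
        ultimately have "f (\<Union>i<m. R (2 * i + j)) + f (R (2 * m + j)) \<le> f (\<Union>i<Suc m. R (2 * i + j))"
          by simp
        moreover have "(\<Sum>i<Suc m. f (R (2 * i + j))) \<le> f (\<Union>i<m. R (2 * i + j)) + f (R (2 * m + j))"
          using Suc.IH by (simp add: add_right_mono)
        ultimately show ?thesis by (rule order_trans[rotated])
      qed (simp add: empty lessThan_Suc)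
    qed (simp add: empty)
    have "(\<Sum>i<n. f (R i)) \<le> f T + f T" for n
    proof -
      have "(\<Sum>i<n. f (R i)) \<le> (\<Sum>i<2 * n. f (R i))"
        by (rule sum_mono2) auto
      also have "\<dots> = (\<Sum>i<n. f (R (2 * i + 0))) + (\<Sum>i<n. f (R (2 * i + 1)))"
        by (induction n) (simp_all add: ac_simps)
      also have "\<dots> \<le> f T + f T"
      proof (rule add_mono)
        show "(\<Sum>i<n. f (R (2 * i + 0))) \<le> f T"
          by (rule order_trans[OF parity mono]) (auto simp: R_def)
        show "(\<Sum>i<n. f (R (2 * i + 1))) \<le> f T"
          by (rule order_trans[OF parity mono]) (auto simp: R_def)
      qed
      finally show ?thesis .
    qed
    then have S_le: "(\<Sum>i. f (R i)) \<le> f T + f T"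
      by (intro suminf_le_const) auto
    define S where "S = (\<Sum>i. f (R i))"
    have S_fin: "S \<noteq> \<infinity>"
      using S_le False unfolding S_def by (auto simp: top_unique)
    \<comment> \<open>Adding the partial sum of the shells on both sides turns the tail into the finite constant
      \<open>S\<close>, which cancels after passing to the supremum over \<open>n\<close>.\<close>
    have bound: "f (C \<inter> T) + f (T - C) + (\<Sum>i<n. f (R i)) \<le> f T + S" for n
    proof -
      have cover: "T - C \<subseteq> A n \<union> (\<Union>i. R (i + n))"
      proof
        fix x assume x: "x \<in> T - C"
        show "x \<in> A n \<union> (\<Union>i. R (i + n))"
        proof (cases "r n \<le> d x")
          case False
          have "d x > 0" unfolding d_def using x C by (intro infdist_pos_not_in_closed) auto
          then obtain k where "r k < d x" unfolding r_def by (metis reals_Archimedean)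
          then have ex: "r k \<le> d x" by simp
          define m where "m = (LEAST k. r k \<le> d x)"
          have m: "r m \<le> d x" unfolding m_def by (rule LeastI) (rule ex)
          have "m > n" using False m r_dec'[of m n] by linarith
          then obtain l where l: "m = Suc l" "l \<ge> n" by (cases m) auto
          have "\<not> r l \<le> d x" using not_less_Least[of l "\<lambda>k. r k \<le> d x"] l by (simp add: m_def)
          then have "x \<in> R l" using l m x by (simp add: R_def)
          then have "x \<in> R ((l - n) + n)" using l by simp
          then show ?thesis by blast
        qed (use x in \<open>auto simp: A_def\<close>)
      qed
      have "f (T - C) \<le> f (A n) + f (\<Union>i. R (i + n))"
        using mono[OF cover] subadd2 order_trans by blast
      also have "\<dots> \<le> f (A n) + (\<Sum>i. f (R (i + n)))"
        by (intro add_left_mono subadd)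
      finally have 1: "f (T - C) \<le> f (A n) + (\<Sum>i. f (R (i + n)))" .
      have 2: "f (C \<inter> T) + f (A n) \<le> f T"
      proof -
        have "f (C \<inter> T) + f (A n) \<le> f ((C \<inter> T) \<union> A n)"
        proof (rule metric[OF r_pos[of n]])
          fix x y assume "x \<in> C \<inter> T" "y \<in> A n"
          then have "d x = 0" "r n \<le> d y" by (auto simp: d_def A_def)
          then show "r n \<le> dist x y" using d_lip[of y x] by (simp add: dist_commute)
        qed
        also have "\<dots> \<le> f T" by (rule mono) (auto simp: A_def)
        finally show ?thesis .
      qed
      have 3: "S = (\<Sum>i. f (R (i + n))) + (\<Sum>i<n. f (R i))"
        unfolding S_def by (rule suminf_offset) simp
      have "f (C \<inter> T) + f (T - C) + (\<Sum>i<n. f (R i))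
          \<le> f (C \<inter> T) + (f (A n) + (\<Sum>i. f (R (i + n)))) + (\<Sum>i<n. f (R i))"
        by (intro add_mono 1) auto
      also have "\<dots> = (f (C \<inter> T) + f (A n)) + S" by (simp add: 3 ac_simps)
      also have "\<dots> \<le> f T + S" by (intro add_right_mono 2)
      finally show ?thesis .
    qed
    have "f (C \<inter> T) + f (T - C) + S = (SUP n. f (C \<inter> T) + f (T - C) + (\<Sum>i<n. f (R i)))"
      unfolding S_def suminf_eq_SUP by (rule ennreal_SUP_add_right) simp
    also have "\<dots> \<le> f T + S" by (rule SUP_least) (rule bound)
    finally have "S + (f (C \<inter> T) + f (T - C)) \<le> S + f T" by (simp add: ac_simps)
    then show ?thesis using S_fin ennreal_add_left_cancel_le by blast
  qed simp
  interpret P: sigma_algebra UNIV "Pow UNIV :: 'a set set" by (rule sigma_algebra_Pow)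
  have oms: "outer_measure_space (Pow UNIV) f"
    unfolding outer_measure_space_def positive_def increasing_def countably_subadditive_def
    using empty mono subadd by auto
  let ?L = "lambda_system UNIV (Pow UNIV) f"
  have ms: "measure_space UNIV ?L f" by (rule P.caratheodory_lemma[OF oms])
  have closed_L: "C \<in> ?L" if "closed C" for C
  proof (cases "C = {}")
    case True
    then show ?thesis using P.lambda_system_empty[of f] empty by (simp add: positive_def)
  next
    case False
    have "f (C \<inter> T) + f (T - C) = f T" for T
    proof (rule antisym)
      show "f (C \<inter> T) + f (T - C) \<le> f T" by (rule closed_split[OF that False])
      have "f T = f ((C \<inter> T) \<union> (T - C))" by (rule arg_cong[of _ _ f]) auto
      then show "f T \<le> f (C \<inter> T) + f (T - C)" using subadd2 by simp
    qed
    then show ?thesis by (simp add: lambda_system_def Diff_eq Int_commute)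
  qed
  have "sigma_sets UNIV (Collect closed) \<subseteq> ?L"
    using ms closed_L unfolding measure_space_def
    by (intro sigma_algebra.sigma_sets_subset) auto
  then have "sets borel \<subseteq> ?L" by (simp add: borel_eq_closed)
  moreover have "sigma_algebra UNIV (sets (borel :: 'a measure))"
    by (metis sets.sigma_algebra_axioms space_borel)
  ultimately show ?thesis by (intro measure_down[OF ms])
qed

section \<open>Hausdorff measure is a Borel measure\<close>

text \<open>A finer mesh leaves fewer admissible coverings.\<close>

lemma hausdorff_pre_antimono: "\<delta> \<le> \<epsilon> \<Longrightarrow> hausdorff_pre k \<epsilon> A \<le> hausdorff_pre k \<delta> A"
  unfolding hausdorff_pre_def by (rule INF_superset_mono) (auto intro: order_trans)

lemma hausdorff_pre_le:
  assumes "A \<subseteq> (\<Union>i. U i)" "\<And>i. bounded (U i)" "\<And>i. diameter (U i) \<le> \<delta>"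
  shows "hausdorff_pre k \<delta> A \<le> (\<Sum>i. hausdorff_weight k (U i))"
  unfolding hausdorff_pre_def using assms by (intro INF_lower) auto

lemma hausdorff_pre_mono: "A \<subseteq> B \<Longrightarrow> hausdorff_pre k \<delta> A \<le> hausdorff_pre k \<delta> B"
  unfolding hausdorff_pre_def by (rule INF_superset_mono) auto

lemma hausdorff_pre_empty: "\<delta> > 0 \<Longrightarrow> hausdorff_pre k \<delta> {} = 0"
  using hausdorff_pre_le[of "{}" "\<lambda>_. {}" \<delta> k] by (simp add: hausdorff_weight_def)

lemma hausdorff_pre_countably_subadditive:
  "hausdorff_pre k \<delta> (\<Union>i. A i) \<le> (\<Sum>i. hausdorff_pre k \<delta> (A i))"
proof (rule ennreal_le_epsilon)
  fix e :: real assume fin: "(\<Sum>i. hausdorff_pre k \<delta> (A i)) < top" and e: "e > 0"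
  have "\<exists>U. A i \<subseteq> (\<Union>j. U j) \<and> (\<forall>j. bounded (U j) \<and> diameter (U j) \<le> \<delta>) \<and>
      (\<Sum>j. hausdorff_weight k (U j)) \<le> hausdorff_pre k \<delta> (A i) + ennreal (e * (1/2) ^ Suc i)" for i
  proof -
    have pos: "e * (1/2) ^ Suc i > 0" using e by simp
    have ninf: "hausdorff_pre k \<delta> (A i) \<noteq> \<infinity>"
      using fin ennreal_suminf_lessD[of "\<lambda>i. hausdorff_pre k \<delta> (A i)" top i] by auto
    show ?thesis using INF_approx_ennreal[OF pos hausdorff_pre_def ninf] by (blast intro: less_imp_le)
  qed
  then obtain U where U: "\<And>i. A i \<subseteq> (\<Union>j. U i j)" "\<And>i j. bounded (U i j)"
      "\<And>i j. diameter (U i j) \<le> \<delta>"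
      "\<And>i. (\<Sum>j. hausdorff_weight k (U i j)) \<le> hausdorff_pre k \<delta> (A i) + ennreal (e * (1/2) ^ Suc i)"
    by metis
  define V where "V = (\<lambda>p. U (fst p) (snd p))"
  have "hausdorff_pre k \<delta> (\<Union>i. A i) \<le> (\<Sum>n. hausdorff_weight k (V (prod_decode n)))"
  proof (rule hausdorff_pre_le)
    show "(\<Union>i. A i) \<subseteq> (\<Union>n. V (prod_decode n))"
    proof
      fix x assume "x \<in> (\<Union>i. A i)"
      then obtain i j where "x \<in> U i j" using U(1) by blast
      then have "x \<in> V (prod_decode (prod_encode (i, j)))" by (simp add: V_def)
      then show "x \<in> (\<Union>n. V (prod_decode n))" by blast
    qed
  qed (auto simp: V_def U)
  also have "\<dots> = (\<Sum>i. \<Sum>j. hausdorff_weight k (U i j))"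
    by (rule suminf_ennreal_2dimen[where f = "\<lambda>p. hausdorff_weight k (V p)"]) (simp add: V_def)
  also have "\<dots> \<le> (\<Sum>i. hausdorff_pre k \<delta> (A i) + ennreal (e * (1/2) ^ Suc i))"
    by (intro suminf_le U) auto
  also have "\<dots> = (\<Sum>i. hausdorff_pre k \<delta> (A i)) + (\<Sum>i. ennreal (e * (1/2) ^ Suc i))"
    by (rule suminf_add[symmetric]) auto
  also have "(\<Sum>i. ennreal (e * (1/2) ^ Suc i)) = ennreal e"
  proof (rule suminf_ennreal_eq)
    show "(\<lambda>i. e * (1/2) ^ Suc i) sums e"
      using sums_mult[OF power_half_series, of e] by simp
  qed (use e in simp)
  finally show "hausdorff_pre k \<delta> (\<Union>i. A i) \<le> (\<Sum>i. hausdorff_pre k \<delta> (A i)) + ennreal e" .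
qed

text \<open>A covering set of diameter below the distance of \<open>A\<close> and \<open>B\<close> meets at most one of the two, so a
covering of the union splits into a covering of \<open>A\<close> and one of \<open>B\<close>.\<close>

lemma hausdorff_pre_add_separated:
  assumes "\<delta> < e" and sep: "\<And>x y. x \<in> A \<Longrightarrow> y \<in> B \<Longrightarrow> e \<le> dist x y"
  shows "hausdorff_pre k \<delta> A + hausdorff_pre k \<delta> B \<le> hausdorff_pre k \<delta> (A \<union> B)"
  unfolding hausdorff_pre_def[of k \<delta> "A \<union> B"]
proof (rule INF_greatest)
  fix U :: "nat \<Rightarrow> 'a set"
  assume "U \<in> {U. A \<union> B \<subseteq> (\<Union>i. U i) \<and> (\<forall>i. bounded (U i) \<and> diameter (U i) \<le> \<delta>)}"
  then have U: "A \<union> B \<subseteq> (\<Union>i. U i)" "\<And>i. bounded (U i)" "\<And>i. diameter (U i) \<le> \<delta>" by auto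
  \<comment> \<open>Empty sets have weight 0 even for \<open>k = 0\<close>, so discarding a set costs nothing.\<close>
  define V where "V X i = (if U i \<inter> X = {} then {} else U i)" for X :: "'a set" and i
  have disj: "V A i = {} \<or> V B i = {}" for i
  proof (rule ccontr)
    assume "\<not> ?thesis"
    then obtain x y where xy: "x \<in> U i" "x \<in> A" "y \<in> U i" "y \<in> B"
      by (auto simp: V_def split: if_splits)
    then have "dist x y \<le> \<delta>" using diameter_bounded_bound[OF U(2) xy(1,3)] U(3)[of i] by linarith
    then show False using sep[OF xy(2,4)] assms(1) by linarith
  qed
  have le: "hausdorff_pre k \<delta> X \<le> (\<Sum>i. hausdorff_weight k (V X i))" if "X \<subseteq> A \<union> B" for X
  proof (rule hausdorff_pre_le)
    show "X \<subseteq> (\<Union>i. V X i)"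
    proof
      fix x assume "x \<in> X"
      then have "x \<in> (\<Union>i. U i)" using U(1) that by blast
      then obtain i where "x \<in> U i" by blast
      then have "x \<in> V X i" using \<open>x \<in> X\<close> by (auto simp: V_def)
      then show "x \<in> (\<Union>i. V X i)" by blast
    qed
    show "diameter (V X i) \<le> \<delta>" for i
      using U(3)[of i] diameter_ge_0[OF U(2), of i] by (auto simp: V_def)
  qed (auto simp: V_def U)
  have "hausdorff_pre k \<delta> A + hausdorff_pre k \<delta> B
      \<le> (\<Sum>i. hausdorff_weight k (V A i)) + (\<Sum>i. hausdorff_weight k (V B i))"
    by (intro add_mono le) auto
  also have "\<dots> = (\<Sum>i. hausdorff_weight k (V A i) + hausdorff_weight k (V B i))"
    by (rule suminf_add) auto
  also have "\<dots> \<le> (\<Sum>i. hausdorff_weight k (U i))"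
  proof (intro suminf_le)
    fix i show "hausdorff_weight k (V A i) + hausdorff_weight k (V B i) \<le> hausdorff_weight k (U i)"
    proof -
      have "V A i = {} \<or> V A i = U i" "V B i = {} \<or> V B i = U i" by (auto simp: V_def)
      moreover have "hausdorff_weight k {} = 0" by (simp add: hausdorff_weight_def)
      ultimately show ?thesis using disj[of i] by auto
    qed
  qed auto
  finally show "hausdorff_pre k \<delta> A + hausdorff_pre k \<delta> B \<le> (\<Sum>i. hausdorff_weight k (U i))" .
qed

lemma measure_space_hausdorff_outer:
  "measure_space UNIV (sets borel) (hausdorff_outer k :: 'a::metric_space set \<Rightarrow> ennreal)"
proof (rule metric_outer_measure_caratheodory)
  show "hausdorff_outer k ({} :: 'a set) = 0"
    unfolding hausdorff_outer_def by (simp add: hausdorff_pre_empty)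
  show "hausdorff_outer k A \<le> hausdorff_outer k B" if "A \<subseteq> B" for A B :: "'a set"
    unfolding hausdorff_outer_def by (intro SUP_mono') (rule hausdorff_pre_mono[OF that])
  show "hausdorff_outer k (\<Union>i. A i) \<le> (\<Sum>i. hausdorff_outer k (A i))" for A :: "nat \<Rightarrow> 'a set"
    unfolding hausdorff_outer_def[of k "\<Union>i. A i"]
  proof (rule SUP_least)
    fix \<delta> :: real assume \<delta>: "\<delta> \<in> {0<..}"
    have "hausdorff_pre k \<delta> (\<Union>i. A i) \<le> (\<Sum>i. hausdorff_pre k \<delta> (A i))"
      by (rule hausdorff_pre_countably_subadditive)
    also have "\<dots> \<le> (\<Sum>i. hausdorff_outer k (A i))"
      unfolding hausdorff_outer_def by (intro suminf_le SUP_upper \<delta>) auto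
    finally show "hausdorff_pre k \<delta> (\<Union>i. A i) \<le> (\<Sum>i. hausdorff_outer k (A i))" .
  qed
  show "hausdorff_outer k A + hausdorff_outer k B \<le> hausdorff_outer k (A \<union> B)"
    if e: "e > 0" and sep: "\<And>x y. x \<in> A \<Longrightarrow> y \<in> B \<Longrightarrow> e \<le> dist x y" for A B :: "'a set" and e
  proof -
    have "hausdorff_outer k A + hausdorff_outer k B
        = (SUP \<delta>\<in>{0<..}. hausdorff_pre k \<delta> A + hausdorff_pre k \<delta> B)"
      unfolding hausdorff_outer_def
    proof (rule SUP_add_directed_ennreal[symmetric])
      fix i j :: real assume "i \<in> {0<..}" "j \<in> {0<..}"
      then show "\<exists>l\<in>{0<..}. hausdorff_pre k i A + hausdorff_pre k j B
          \<le> hausdorff_pre k l A + hausdorff_pre k l B"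
        by (intro bexI[of _ "min i j"] add_mono hausdorff_pre_antimono) auto
    qed
    also have "\<dots> \<le> hausdorff_outer k (A \<union> B)"
    proof (rule SUP_least)
      fix \<delta> :: real assume "\<delta> \<in> {0<..}"
      define \<eta> where "\<eta> = min \<delta> (e / 2)"
      have \<eta>: "\<eta> \<in> {0<..}" "\<eta> \<le> \<delta>" "\<eta> < e" using \<open>\<delta> \<in> {0<..}\<close> e by (auto simp: \<eta>_def min_def)
      have "hausdorff_pre k \<delta> A + hausdorff_pre k \<delta> B \<le> hausdorff_pre k \<eta> A + hausdorff_pre k \<eta> B"
        by (intro add_mono hausdorff_pre_antimono \<eta>)
      also have "\<dots> \<le> hausdorff_pre k \<eta> (A \<union> B)"
        using \<eta>(3) sep by (rule hausdorff_pre_add_separated)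
      also have "\<dots> \<le> hausdorff_outer k (A \<union> B)"
        unfolding hausdorff_outer_def using \<eta>(1) by (rule SUP_upper)
      finally show "hausdorff_pre k \<delta> A + hausdorff_pre k \<delta> B \<le> hausdorff_outer k (A \<union> B)" .
    qed
    finally show ?thesis .
  qed
qed

lemma sets_hausdorff_measure [simp, measurable_cong]: "sets (hausdorff_measure k) = sets borel"
  unfolding hausdorff_measure_def
  by (metis sets.sigma_sets_eq sets.space_closed sets_measure_of space_borel)

lemma space_hausdorff_measure [simp]: "space (hausdorff_measure k) = UNIV"
  unfolding hausdorff_measure_def by (simp add: space_measure_of_conv)

text \<open>Were \<^const>\<open>hausdorff_outer\<close> not countably additive on the Borel sets, \<^const>\<open>measure_of\<close> would
return the zero measure; this lemma rules that out and makes the measure computable by coverings.\<close>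

lemma emeasure_hausdorff_measure:
  assumes "A \<in> sets borel"
  shows "emeasure (hausdorff_measure k) A = hausdorff_outer k A"
proof (rule emeasure_measure_of[OF hausdorff_measure_def])
  show "positive (sets (hausdorff_measure k)) (hausdorff_outer k)"
    "countably_additive (sets (hausdorff_measure k)) (hausdorff_outer k)"
    using measure_space_hausdorff_outer[of k] by (auto simp: measure_space_def)
qed (use assms in auto)

section \<open>Finiteness of the surface measure of the sphere\<close>

text \<open>The balls of radius \<open>a\<close> about the points of \<open>F\<close> are disjoint and lie in the annulus
\<open>1 - a \<le> norm x \<le> 1 + a\<close>, whose volume is of order \<open>a\<close>, while each ball has volume of order
\<open>a ^ DIM('a)\<close>.\<close>

lemma card_separated_sphere_le:
  fixes F :: "'a::euclidean_space set"
  assumes F: "finite F" "F \<subseteq> sphere 0 1"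
    and sep: "\<And>x y. x \<in> F \<Longrightarrow> y \<in> F \<Longrightarrow> x \<noteq> y \<Longrightarrow> 2 * a \<le> dist x y"
    and a: "0 < a" "a \<le> 1"
  shows "real (card F) * a ^ (DIM('a) - 1) \<le> 2 * real DIM('a) * 2 ^ DIM('a)"
proof -
  let ?n = "DIM('a)"
  let ?c = "unit_ball_vol (real ?n)"
  have c: "?c > 0" by simp
  have sub: "ball 0 (1 - a) \<union> (\<Union>x\<in>F. ball x a) \<subseteq> cball (0::'a) (1 + a)"
  proof
    fix y :: 'a assume "y \<in> ball 0 (1 - a) \<union> (\<Union>x\<in>F. ball x a)"
    then show "y \<in> cball 0 (1 + a)"
    proof
      assume "y \<in> (\<Union>x\<in>F. ball x a)"
      then obtain x where "x \<in> F" "dist x y < a" by auto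
      then show ?thesis using F(2) norm_triangle_sub[of y x] by (auto simp: dist_norm norm_minus_commute)
    qed (use a in auto)
  qed
  have disj: "ball 0 (1 - a) \<inter> (\<Union>x\<in>F. ball x a) = {}"
  proof (rule ccontr)
    assume "\<not> ?thesis"
    then obtain x y where "x \<in> F" "dist x y < a" "norm y < 1 - a" by auto
    then show False using F(2) norm_triangle_sub[of x y] by (auto simp: dist_norm)
  qed
  have "disjoint_family_on (\<lambda>x. ball x a) F"
    unfolding disjoint_family_on_def
  proof (intro ballI impI, rule ccontr)
    fix x y assume xy: "x \<in> F" "y \<in> F" "x \<noteq> y" and "ball x a \<inter> ball y a \<noteq> {}"
    then obtain z where "dist x z < a" "dist y z < a" by auto
    then show False using sep[OF xy] dist_triangle2[of x y z] by linarith
  qed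
  then have U: "emeasure lborel (\<Union>x\<in>F. ball x a) = ennreal (card F * (?c * a ^ ?n))"
    using a F(1) by (subst sum_emeasure[symmetric]) (auto simp: emeasure_ball ennreal_mult ennreal_of_nat_eq_real_of_nat)
  have "ennreal (?c * (1 - a) ^ ?n + card F * (?c * a ^ ?n))
      = emeasure lborel (ball (0::'a) (1 - a)) + emeasure lborel (\<Union>x\<in>F. ball x a)"
    using a by (simp add: U emeasure_ball)
  also have "\<dots> = emeasure lborel (ball 0 (1 - a) \<union> (\<Union>x\<in>F. ball x a))"
    using disj F(1) by (intro plus_emeasure) (auto intro!: borel_open open_UN)
  also have "\<dots> \<le> emeasure lborel (cball (0::'a) (1 + a))"
    by (intro emeasure_mono sub) simp
  also have "\<dots> = ennreal (?c * (1 + a) ^ ?n)" using a by (simp add: emeasure_cball)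
  finally have "?c * (1 - a) ^ ?n + card F * (?c * a ^ ?n) \<le> ?c * (1 + a) ^ ?n"
    using a by (subst (asm) ennreal_le_iff) auto
  then have "?c * (card F * a ^ ?n) \<le> ?c * ((1 + a) ^ ?n - (1 - a) ^ ?n)"
    by (simp add: algebra_simps)
  then have "card F * a ^ ?n \<le> (1 + a) ^ ?n - (1 - a) ^ ?n"
    using c by simp
  \<comment> \<open>Factoring the difference of powers exhibits the thickness \<open>2 * a\<close> of the annulus.\<close>
  also have "\<dots> = (2 * a) * (\<Sum>i<?n. (1 - a) ^ (?n - Suc i) * (1 + a) ^ i)"
    by (subst power_diff_sumr2) simp
  also have "\<dots> \<le> (2 * a) * (\<Sum>i<?n. 1 * 2 ^ ?n)"
  proof (intro mult_left_mono sum_mono mult_mono)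
    fix i assume "i \<in> {..<?n}"
    have "(1 + a) ^ i \<le> 2 ^ i" using a by (intro power_mono) auto
    also have "\<dots> \<le> 2 ^ ?n" using \<open>i \<in> {..<?n}\<close> by (intro power_increasing) auto
    finally show "(1 + a) ^ i \<le> 2 ^ ?n" .
    show "(1 - a) ^ (?n - Suc i) \<le> 1" using a by (intro power_le_one) auto
  qed (use a in auto)
  finally have "card F * a ^ ?n \<le> a * (2 * real ?n * 2 ^ ?n)" by (simp add: ac_simps)
  moreover have "a ^ ?n = a * a ^ (?n - 1)"
    by (metis DIM_positive power_eq_if not_gr_zero)
  ultimately have "a * (card F * a ^ (?n - 1)) \<le> a * (2 * real ?n * 2 ^ ?n)" by (simp add: ac_simps)
  then show ?thesis using a by simp
qed

text \<open>A separated subset of the sphere of greatest cardinality is a net.\<close>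

lemma sphere_net:
  assumes a: "0 < a" "a \<le> 1"
  obtains F :: "'a::euclidean_space set" where "finite F"
    "sphere 0 1 \<subseteq> (\<Union>x\<in>F. ball x (2 * a))"
    "real (card F) * a ^ (DIM('a) - 1) \<le> 2 * real DIM('a) * 2 ^ DIM('a)"
proof -
  let ?B = "2 * real DIM('a) * 2 ^ DIM('a)"
  define P where "P F \<longleftrightarrow> finite F \<and> F \<subseteq> sphere 0 1 \<and>
     (\<forall>x\<in>F. \<forall>y\<in>F. x \<noteq> y \<longrightarrow> 2 * a \<le> dist x y)" for F :: "'a set"
  have bd: "real (card F) * a ^ (DIM('a) - 1) \<le> ?B" if "P F" for F
    using that a by (intro card_separated_sphere_le) (auto simp: P_def)
  have "card F < Suc (nat \<lceil>?B / a ^ (DIM('a) - 1)\<rceil>)" if "P F" for F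
  proof -
    have "real (card F) \<le> ?B / a ^ (DIM('a) - 1)"
      using bd[OF that] a by (simp add: pos_le_divide_eq)
    then show ?thesis by linarith
  qed
  moreover have "P {}" by (simp add: P_def)
  ultimately have "\<exists>F. P F \<and> (\<forall>G. P G \<longrightarrow> card G \<le> card F)"
    by (intro ex_has_greatest_nat[of P "{}" card "Suc (nat \<lceil>?B / a ^ (DIM('a) - 1)\<rceil>)"]) auto
  then obtain F where F: "P F" and max: "\<And>G. P G \<Longrightarrow> card G \<le> card F"
    by auto
  have "u \<in> (\<Union>x\<in>F. ball x (2 * a))" if "u \<in> sphere 0 1" for u
  proof (rule ccontr)
    assume "u \<notin> (\<Union>x\<in>F. ball x (2 * a))"
    then have far: "\<And>x. x \<in> F \<Longrightarrow> 2 * a \<le> dist x u" by fastforce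
    then have "u \<notin> F" using a by force
    have "P (insert u F)" using F far that by (auto simp: P_def dist_commute)
    from max[OF this] \<open>u \<notin> F\<close> F show False by (simp add: P_def)
  qed
  then have "sphere 0 1 \<subseteq> (\<Union>x\<in>F. ball x (2 * a))" by blast
  then show ?thesis using that[of F] bd[OF F] F by (simp add: P_def)
qed

text \<open>A net at scale \<open>a\<close> covers the sphere by about \<open>a ^ - (DIM('a) - 1)\<close> balls of radius
\<open>2 * a\<close>, whose total weight stays bounded as \<open>a\<close> tends to 0.\<close>

lemma hausdorff_outer_sphere_finite:
  "hausdorff_outer (DIM('a) - 1) (sphere (0::'a::euclidean_space) 1) < \<infinity>"
proof -
  let ?k = "DIM('a) - 1"
  let ?B = "2 * real DIM('a) * 2 ^ DIM('a)"
  let ?v = "unit_ball_vol (real ?k)"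
  have main: "hausdorff_pre ?k \<delta> (sphere (0::'a) 1) \<le> ennreal (?v * 2 ^ ?k * ?B)"
    if \<delta>: "0 < \<delta>" "\<delta> \<le> 1" for \<delta>
  proof -
    define a where "a = \<delta> / 4"
    have a: "0 < a" "a \<le> 1" using \<delta> by (auto simp: a_def)
    obtain F :: "'a set" where F: "finite F" "sphere 0 1 \<subseteq> (\<Union>x\<in>F. ball x (2 * a))"
      "real (card F) * a ^ ?k \<le> ?B"
      using sphere_net[OF a] by blast
    obtain h where h: "bij_betw h {0..<card F} F" using ex_bij_betw_nat_finite[OF F(1)] by blast
    define U where "U i = (if i < card F then ball (h i) (2 * a) else {})" for i
    have "hausdorff_pre ?k \<delta> (sphere (0::'a) 1) \<le> (\<Sum>i. hausdorff_weight ?k (U i))"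
    proof (rule hausdorff_pre_le)
      show "sphere 0 1 \<subseteq> (\<Union>i. U i)"
      proof
        fix u :: 'a assume "u \<in> sphere 0 1"
        then obtain x where x: "x \<in> F" "u \<in> ball x (2 * a)" using F(2) by blast
        then obtain i where "i < card F" "h i = x" using h unfolding bij_betw_def by force
        then have "u \<in> U i" using x by (simp add: U_def)
        then show "u \<in> (\<Union>i. U i)" by blast
      qed
    qed (use a \<delta> in \<open>auto simp: U_def a_def\<close>)
    also have "\<dots> = (\<Sum>i<card F. hausdorff_weight ?k (U i))"
      by (rule suminf_finite) (auto simp: U_def hausdorff_weight_def)
    also have "\<dots> = (\<Sum>i<card F. ennreal (?v * (2 * a) ^ ?k))"
      using a by (intro sum.cong) (auto simp: U_def hausdorff_weight_def)
    also have "\<dots> = ennreal (?v * 2 ^ ?k * (real (card F) * a ^ ?k))"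
      using a by (simp add: ennreal_of_nat_eq_real_of_nat ennreal_mult[symmetric] power_mult_distrib ac_simps)
    also have "\<dots> \<le> ennreal (?v * 2 ^ ?k * ?B)"
      by (intro ennreal_leI mult_left_mono F) simp
    finally show ?thesis .
  qed
  have "hausdorff_outer ?k (sphere (0::'a) 1) \<le> ennreal (?v * 2 ^ ?k * ?B)"
    unfolding hausdorff_outer_def
  proof (rule SUP_least)
    fix \<delta> :: real assume "\<delta> \<in> {0<..}"
    have "hausdorff_pre ?k \<delta> (sphere (0::'a) 1) \<le> hausdorff_pre ?k (min \<delta> 1) (sphere (0::'a) 1)"
      by (rule hausdorff_pre_antimono) simp
    also have "\<dots> \<le> ennreal (?v * 2 ^ ?k * ?B)" using \<open>\<delta> \<in> {0<..}\<close> by (intro main) auto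
    finally show "hausdorff_pre ?k \<delta> (sphere (0::'a) 1) \<le> ennreal (?v * 2 ^ ?k * ?B)" .
  qed
  then show ?thesis by (simp add: le_less_trans)
qed

section \<open>Positivity of the surface measure on open sets\<close>

definition unit_cone :: "'a::real_normed_vector set \<Rightarrow> 'a set" where
  "unit_cone X = (\<lambda>(t, u). t *\<^sub>R u) ` ({0..1} \<times> X)"

lemma compact_unit_cone: "compact X \<Longrightarrow> compact (unit_cone X)"
  unfolding unit_cone_def case_prod_unfold
  by (intro compact_continuous_image continuous_intros compact_Times compact_Icc)

text \<open>The cone over a piece of the sphere of diameter \<open>d\<close> is a bundle of segments; it is covered by
about \<open>1 / d\<close> balls of radius \<open>2 * d\<close> placed along one of them. This bounds the Lebesgue
measure of a cone in the ambient space by the Hausdorff weight of its base on the sphere. With \<open>0 ^ 0 = 1\<close> the bound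
also covers a single point in dimension one, whose cone is a segment.\<close>

lemma emeasure_unit_cone_le:
  fixes X :: "'a::euclidean_space set"
  assumes X: "compact X" "X \<subseteq> sphere 0 1" and d: "0 \<le> d" "d \<le> 1"
    and diam: "\<And>x y. x \<in> X \<Longrightarrow> y \<in> X \<Longrightarrow> dist x y \<le> d"
  shows "emeasure lborel (unit_cone X)
           \<le> ennreal (3 * 2 ^ DIM('a) * unit_ball_vol (DIM('a)) * d ^ (DIM('a) - 1))"
proof (cases "X = {}")
  case True
  then show ?thesis by (simp add: unit_cone_def)
next
  case False
  then obtain u0 where u0: "u0 \<in> X" by blast
  let ?n = "DIM('a)"
  let ?C = "3 * 2 ^ ?n * unit_ball_vol (real ?n)"
  \<comment> \<open>The covering needs balls of positive radius, so \<open>d = 0\<close> is only reached as a limit of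
      larger scales \<open>e\<close>.\<close>
  have le: "emeasure lborel (unit_cone X) \<le> ennreal (?C * e ^ (?n - 1))" if e: "d < e" "e \<le> 2" for e
  proof -
    have e0: "e > 0" using d e by linarith
    let ?N = "nat \<lfloor>1 / e\<rfloor>"
    have "unit_cone X \<subseteq> (\<Union>j\<in>{..?N}. cball ((real j * e) *\<^sub>R u0) (2 * e))"
    proof
      fix x assume "x \<in> unit_cone X"
      then obtain t u where x: "x = t *\<^sub>R u" "0 \<le> t" "t \<le> 1" "u \<in> X"
        by (auto simp: unit_cone_def)
      define j where "j = nat \<lfloor>t / e\<rfloor>"
      have "real j = of_int \<lfloor>t / e\<rfloor>" using x e0 by (simp add: j_def)
      then have "real j \<le> t / e" "t / e < real j + 1" by linarith+
      then have j: "real j * e \<le> t" "t < real j * e + e"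
        using e0 by (simp_all add: field_simps)
      have "j \<le> ?N" unfolding j_def using x e0
        by (intro nat_mono floor_mono divide_right_mono) auto
      have "x - (real j * e) *\<^sub>R u0 = (t - real j * e) *\<^sub>R u + (real j * e) *\<^sub>R (u - u0)"
        by (simp add: x algebra_simps)
      then have "norm (x - (real j * e) *\<^sub>R u0) \<le> norm ((t - real j * e) *\<^sub>R u) + norm ((real j * e) *\<^sub>R (u - u0))"
        by (metis norm_triangle_ineq)
      also have "\<dots> = \<bar>t - real j * e\<bar> * 1 + (real j * e) * dist u u0"
        using x(4) X(2) e0 by (auto simp: dist_norm)
      also have "\<dots> \<le> e * 1 + 1 * e"
      proof (intro add_mono mult_mono)
        show "dist u u0 \<le> e" using diam[OF x(4) u0] e by linarith
      qed (use j x e0 in auto)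
      finally have "x \<in> cball ((real j * e) *\<^sub>R u0) (2 * e)"
        by (simp add: dist_norm norm_minus_commute)
      then show "x \<in> (\<Union>j\<in>{..?N}. cball ((real j * e) *\<^sub>R u0) (2 * e))" using \<open>j \<le> ?N\<close> by blast
    qed
    then have "emeasure lborel (unit_cone X) \<le> emeasure lborel (\<Union>j\<in>{..?N}. cball ((real j * e) *\<^sub>R u0) (2 * e))"
      by (intro emeasure_mono) auto
    also have "\<dots> \<le> (\<Sum>j\<in>{..?N}. emeasure lborel (cball ((real j * e) *\<^sub>R u0) (2 * e)))"
      by (intro emeasure_subadditive_finite) auto
    also have "\<dots> = ennreal ((real ?N + 1) * (unit_ball_vol (real ?n) * (2 * e) ^ ?n))"
      using e0 by (simp add: emeasure_cball ennreal_mult[symmetric] ennreal_of_nat_eq_real_of_nat flip: ennreal_1 ennreal_plus)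
    \<comment> \<open>The constant 3 absorbs the rounding in the number of balls, as \<open>e \<le> 2\<close>.\<close>
    also have "\<dots> \<le> ennreal (3 / e * (unit_ball_vol (real ?n) * (2 * e) ^ ?n))"
    proof (intro ennreal_leI mult_right_mono)
      have "real ?N \<le> 1 / e" using e0 by simp
      moreover have "1 \<le> 2 / e" using e e0 by simp
      ultimately show "real ?N + 1 \<le> 3 / e" by (simp add: field_simps)
    qed (use e0 in auto)
    also have "3 / e * (unit_ball_vol (real ?n) * (2 * e) ^ ?n) = ?C * e ^ (?n - 1)"
    proof -
      have "e ^ ?n = e * e ^ (?n - 1)" by (metis DIM_positive power_eq_if not_gr_zero)
      then show ?thesis using e0 by (simp add: power_mult_distrib)
    qed
    finally show ?thesis .
  qed
  let ?e = "\<lambda>m. d + inverse (real (Suc m))"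
  have lim: "(\<lambda>m. ennreal (?C * ?e m ^ (?n - 1))) \<longlonglongrightarrow> ennreal (?C * (d + 0) ^ (?n - 1))"
    by (intro tendsto_ennrealI tendsto_intros LIMSEQ_inverse_real_of_nat)
  have le_e: "emeasure lborel (unit_cone X) \<le> ennreal (?C * ?e m ^ (?n - 1))" for m
  proof (rule le)
    have "inverse (real (Suc m)) \<le> 1" by (simp add: field_simps)
    then show "?e m \<le> 2" using d by linarith
  qed simp
  have "emeasure lborel (unit_cone X) \<le> ennreal (?C * (d + 0) ^ (?n - 1))"
    by (rule LIMSEQ_le_const[OF lim]) (use le_e in blast)
  then show ?thesis by simp
qed

text \<open>The cone over a nonempty relatively open part of the sphere contains a nonempty open set \<open>G\<close>. Any
covering of that part by small sets covers \<open>G\<close> by the cones over them, so its total weight is at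
least a positive constant times the Lebesgue measure of \<open>G\<close>.\<close>

lemma hausdorff_outer_sphere_open_pos:
  fixes V :: "'a::euclidean_space set"
  assumes V: "open V" and ne: "V \<inter> sphere 0 1 \<noteq> {}"
  shows "hausdorff_outer (DIM('a) - 1) (V \<inter> sphere 0 1) > 0"
proof -
  let ?k = "DIM('a) - 1"
  let ?A = "V \<inter> sphere 0 1"
  define v where "v = unit_ball_vol (real ?k)"
  have v_pos: "v > 0" unfolding v_def by (rule unit_ball_vol_pos) simp
  define C where "C = 3 * 2 ^ DIM('a) * unit_ball_vol (real DIM('a)) * 2 ^ ?k / v"
  have C: "C > 0" using v_pos by (simp add: C_def)
  define G where "G = (ball 0 1 - {0}) \<inter> (\<lambda>x. x /\<^sub>R norm x) -` V"
  have G_open: "open G" unfolding G_def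
    by (intro continuous_open_preimage V continuous_intros) (auto intro: open_Diff)
  obtain u where u: "u \<in> V" "norm u = 1" using ne by auto
  have "(1/2) *\<^sub>R u \<in> G" using u by (auto simp: G_def)
  then obtain r where r: "r > 0" "ball ((1/2) *\<^sub>R u) r \<subseteq> G"
    using G_open open_contains_ball by blast
  have "0 < emeasure lborel (ball ((1/2) *\<^sub>R u) r)" using r by (simp add: emeasure_ball)
  also have "\<dots> \<le> emeasure lborel G" using r G_open by (intro emeasure_mono) auto
  finally have G_pos: "0 < emeasure lborel G" .
  have "emeasure lborel G / ennreal C \<le> hausdorff_pre ?k 1 ?A"
    unfolding hausdorff_pre_def
  proof (rule INF_greatest)
    fix U :: "nat \<Rightarrow> 'a set"
    assume "U \<in> {U. ?A \<subseteq> (\<Union>i. U i) \<and> (\<forall>i. bounded (U i) \<and> diameter (U i) \<le> 1)}"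
    then have U: "?A \<subseteq> (\<Union>i. U i)" "\<And>i. bounded (U i)" "\<And>i. diameter (U i) \<le> 1" by auto
    \<comment> \<open>The closure has the same diameter and makes the cone compact, hence measurable.\<close>
    define X where "X i = closure (U i) \<inter> sphere 0 1" for i
    have Xc: "compact (X i)" for i unfolding X_def by (intro closed_Int_compact) auto
    have "G \<subseteq> (\<Union>i. unit_cone (X i))"
    proof
      fix x assume "x \<in> G"
      then have x: "x \<noteq> 0" "norm x < 1" "x /\<^sub>R norm x \<in> ?A" by (auto simp: G_def)
      then obtain i where "x /\<^sub>R norm x \<in> U i" using U(1) by blast
      then have "x /\<^sub>R norm x \<in> X i" using x closure_subset[of "U i"] by (auto simp: X_def)
      then have "norm x *\<^sub>R (x /\<^sub>R norm x) \<in> unit_cone (X i)"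
        unfolding unit_cone_def using x by (intro image_eqI[of _ _ "(norm x, x /\<^sub>R norm x)"]) auto
      then show "x \<in> (\<Union>i. unit_cone (X i))" using x by auto
    qed
    then have "emeasure lborel G \<le> emeasure lborel (\<Union>i. unit_cone (X i))"
      using Xc by (intro emeasure_mono sets.countable_UN) (auto simp: compact_imp_closed compact_unit_cone)
    also have "\<dots> \<le> (\<Sum>i. emeasure lborel (unit_cone (X i)))"
      using Xc by (intro emeasure_subadditive_countably) (auto simp: compact_imp_closed compact_unit_cone)
    also have "\<dots> \<le> (\<Sum>i. ennreal C * hausdorff_weight ?k (U i))"
    proof (intro suminf_le)
      fix i
      show "emeasure lborel (unit_cone (X i)) \<le> ennreal C * hausdorff_weight ?k (U i)"
      proof (cases "U i = {}")
        case True
        then show ?thesis by (simp add: X_def unit_cone_def)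
      next
        case False
        have d: "0 \<le> diameter (U i)" by (rule diameter_ge_0[OF U(2)])
        have "emeasure lborel (unit_cone (X i)) \<le>
            ennreal (3 * 2 ^ DIM('a) * unit_ball_vol (DIM('a)) * diameter (U i) ^ ?k)"
        proof (rule emeasure_unit_cone_le[OF Xc _ d U(3)])
          fix x y assume "x \<in> X i" "y \<in> X i"
          then have "dist x y \<le> diameter (closure (U i))"
            using U(2) by (intro diameter_bounded_bound) (auto simp: X_def)
          then show "dist x y \<le> diameter (U i)" by (simp add: diameter_closure U(2))
        qed (simp add: X_def)
        also have "\<dots> = ennreal (C * (v * (diameter (U i) / 2) ^ ?k))"
          using v_pos by (intro arg_cong[of _ _ ennreal]) (simp add: C_def power_divide)
        also have "\<dots> = ennreal C * hausdorff_weight ?k (U i)"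
          using False C d v_pos by (simp add: hausdorff_weight_def ennreal_mult v_def)
        finally show ?thesis .
      qed
    qed auto
    also have "\<dots> = ennreal C * (\<Sum>i. hausdorff_weight ?k (U i))" by simp
    finally show "emeasure lborel G / ennreal C \<le> (\<Sum>i. hausdorff_weight ?k (U i))"
      using C by (intro divide_le_posI_ennreal) (auto simp: mult.commute)
  qed
  also have "\<dots> \<le> hausdorff_outer ?k ?A"
    unfolding hausdorff_outer_def by (rule SUP_upper) simp
  finally have "emeasure lborel G / ennreal C \<le> hausdorff_outer ?k ?A" .
  moreover have "0 < emeasure lborel G / ennreal C"
    using G_pos by (simp add: ennreal_zero_less_divide)
  ultimately show ?thesis by (rule less_le_trans[rotated])
qed

section \<open>Integration over the sphere\<close>

lemma continuous_set_integrable_sphere: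
  fixes f :: "'a::euclidean_space \<Rightarrow> real"
  assumes "continuous_on (sphere 0 1) f"
  shows "set_integrable (hausdorff_measure (DIM('a) - 1)) (sphere 0 1) f"
proof -
  let ?M = "hausdorff_measure (DIM('a) - 1) :: 'a measure"
  have "compact (f ` sphere 0 1)" using assms by (intro compact_continuous_image) auto
  then obtain B where B: "\<And>u. u \<in> sphere 0 1 \<Longrightarrow> norm (f u) \<le> B"
    using compact_imp_bounded bounded_iff by (metis imageI)
  have meas: "(\<lambda>u. indicator (sphere 0 1) u *\<^sub>R f u) \<in> borel_measurable ?M"
    using borel_measurable_continuous_on_indicator[OF _ assms]
    by (simp add: measurable_cong_sets[OF sets_hausdorff_measure refl])
  show ?thesis unfolding set_integrable_def
  proof (rule integrableI_bounded_set[OF _ meas])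
    show "sphere 0 1 \<in> sets ?M" by simp
    show "emeasure ?M (sphere 0 1) < \<infinity>"
      using hausdorff_outer_sphere_finite[where 'a='a] by (simp add: emeasure_hausdorff_measure)
    show "AE u in ?M. u \<in> sphere 0 1 \<longrightarrow> norm (indicator (sphere 0 1) u *\<^sub>R f u) \<le> B"
      using B by (intro AE_I2) auto
  qed auto
qed

text \<open>A nonnegative function with zero integral vanishes almost everywhere; by continuity the set where it
is positive is relatively open, and nonempty relatively open subsets of the sphere are not null.\<close>

lemma continuous_nonneg_sphere_integral_eq_0:
  fixes f :: "'a::euclidean_space \<Rightarrow> real"
  assumes cont: "continuous_on (sphere 0 1) f"
    and nonneg: "\<And>u. u \<in> sphere 0 1 \<Longrightarrow> 0 \<le> f u"
    and zero: "(LINT u:sphere 0 1|hausdorff_measure (DIM('a) - 1). f u) = 0"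
    and u: "u \<in> sphere 0 1"
  shows "f u = 0"
proof (rule ccontr)
  assume "f u \<noteq> 0"
  then have pos: "f u > 0" using nonneg[OF u] by simp
  let ?M = "hausdorff_measure (DIM('a) - 1) :: 'a measure"
  have "openin (top_of_set (sphere 0 1)) (sphere 0 1 \<inter> f -` {0<..})"
    by (rule continuous_openin_preimage_gen[OF cont]) simp
  then obtain V where V: "open V" "sphere 0 1 \<inter> f -` {0<..} = sphere 0 1 \<inter> V"
    by (metis openin_open)
  have "AE x in ?M. indicator (sphere 0 1) x *\<^sub>R f x = 0"
    using continuous_set_integrable_sphere[OF cont] zero nonneg
    unfolding set_integrable_def set_lebesgue_integral_def
    by (subst (asm) integral_nonneg_eq_0_iff_AE) (auto intro!: AE_I2 simp: indicator_def)
  then have "AE x in ?M. x \<notin> V \<inter> sphere 0 1"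
  proof (rule AE_mp, intro AE_I2 impI notI)
    fix x assume "indicator (sphere 0 1) x *\<^sub>R f x = 0" "x \<in> V \<inter> sphere 0 1"
    moreover from this have "x \<in> sphere 0 1 \<inter> f -` {0<..}" by (simp add: V(2))
    ultimately show False by simp
  qed
  then have "emeasure ?M (V \<inter> sphere 0 1) = 0"
    using V(1) by (subst (asm) AE_iff_measurable[of "V \<inter> sphere 0 1"]) (auto simp: space_hausdorff_measure)
  moreover have "V \<inter> sphere 0 1 \<noteq> {}" using u pos V(2) by auto
  ultimately show False
    using hausdorff_outer_sphere_open_pos[OF V(1)] V(1)
    by (simp add: emeasure_hausdorff_measure)
qed

section \<open>Supporting lines and the equality case\<close>

lemma strictly_convex_on_imp_convex_on:
  assumes "strictly_convex_on S f"
  shows "convex_on S f"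
proof (rule convex_onI)
  fix t x y :: real assume *: "0 < t" "t < 1" "x \<in> S" "y \<in> S"
  show "f ((1 - t) *\<^sub>R x + t *\<^sub>R y) \<le> (1 - t) * f x + t * f y"
  proof (cases "x = y")
    case True
    then show ?thesis by (simp add: algebra_simps)
  next
    case False
    then show ?thesis using assms * by (auto simp: strictly_convex_on_def less_imp_le)
  qed
qed (use assms in \<open>simp add: strictly_convex_on_def\<close>)

text \<open>A convex function lies above a supporting line; if it touched the line again at \<open>y\<close>, strict
convexity would force it below the line at the midpoint of \<open>x\<close> and \<open>y\<close>.\<close>

lemma strictly_convex_on_supporting_line:
  assumes f: "strictly_convex_on S f" and x: "x \<in> interior S"
  obtains p where "\<And>y. y \<in> S \<Longrightarrow> y \<noteq> x \<Longrightarrow> f x + p * (y - x) < f y"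
proof -
  define p where "p = Inf ((\<lambda>t. (f x - f t) / (x - t)) ` ({x<..} \<inter> S))"
  have le: "f x + p * (y - x) \<le> f y" if "y \<in> S" for y
    unfolding p_def using convex_le_Inf_differential[OF strictly_convex_on_imp_convex_on[OF f] x that] .
  have xS: "x \<in> S" using x interior_subset by blast
  have "f x + p * (y - x) < f y" if y: "y \<in> S" "y \<noteq> x" for y
  proof -
    let ?m = "(1 - 1/2) * x + 1/2 * y"
    have mid: "f ?m < (1 - 1/2) * f x + 1/2 * f y"
      using f xS y unfolding strictly_convex_on_def by (metis greaterThanLessThan_iff half_gt_zero_iff less_numeral_extra(1) field_sum_of_halves less_add_same_cancel1)
    have "convex S" using f by (simp add: strictly_convex_on_def)
    then have "(1 - 1/2) *\<^sub>R x + (1/2) *\<^sub>R y \<in> S" using xS y by (intro convexD_alt) auto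
    then have "?m \<in> S" by simp
    then have "f x + p * (?m - x) \<le> f ?m" by (rule le)
    moreover have "p * (?m - x) = p * (y - x) / 2" by (simp add: field_simps)
    ultimately show ?thesis using mid by argo
  qed
  then show ?thesis using that by blast
qed

text \<open>The difference of the two sides of \<open>ab\<close> is an f-divergence of the densities \<open>a\<close> and \<open>b\<close>,
normalised to vanish for \<open>a = b\<close>, and \<open>ba\<close> is the same with the roles exchanged.
With \<open>gap\<close> the vertical distance from the supporting line at 1 with slope \<open>p\<close> to the graph of \<open>f\<close>, the
integral of \<open>gap (a / b) * b\<close> is \<open>p\<close> times the integral of \<open>b - a\<close>, and exchanging \<open>a\<close> and \<open>b\<close>
gives the opposite value. So the two nonnegative integrands have total integral 0 and vanish, and
\<open>gap\<close> vanishes only at 1.\<close>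

lemma f_divergence_equality:
  fixes a b :: "'a::euclidean_space \<Rightarrow> real"
  assumes f: "strictly_convex_on {0<..} f"
    and cont: "continuous_on (sphere 0 1) a" "continuous_on (sphere 0 1) b"
    and pos: "\<And>u. u \<in> sphere 0 1 \<Longrightarrow> a u > 0" "\<And>u. u \<in> sphere 0 1 \<Longrightarrow> b u > 0"
    and ab: "(LINT u:sphere 0 1|hausdorff_measure (DIM('a) - 1). f (a u / b u) * b u)
               = f 1 * (LINT u:sphere 0 1|hausdorff_measure (DIM('a) - 1). b u)"
    and ba: "(LINT u:sphere 0 1|hausdorff_measure (DIM('a) - 1). f (b u / a u) * a u)
               = f 1 * (LINT u:sphere 0 1|hausdorff_measure (DIM('a) - 1). a u)"
    and u: "u \<in> sphere 0 1"
  shows "a u = b u"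
proof -
  let ?M = "hausdorff_measure (DIM('a) - 1) :: 'a measure"
  let ?S = "sphere (0::'a) 1"
  obtain p where p: "\<And>t. t > 0 \<Longrightarrow> t \<noteq> 1 \<Longrightarrow> f 1 + p * (t - 1) < f t"
    using strictly_convex_on_supporting_line[OF f, of 1] by (auto simp: interior_open)
  have f_cont: "continuous_on {0<..} f"
    by (intro convex_on_continuous strictly_convex_on_imp_convex_on f) simp
  define gap where "gap t = f t - f 1 - p * (t - 1)" for t
  have gap_nonneg: "gap t \<ge> 0" and gap_eq_0: "gap t = 0 \<Longrightarrow> t = 1" if "t > 0" for t
    using p[OF that] by (cases "t = 1"; force simp: gap_def)+
  have cont_f_ratio: "continuous_on ?S (\<lambda>u. f (c u / d u) * d u)"
    if "continuous_on ?S c" "continuous_on ?S d"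
      "\<And>u. u \<in> ?S \<Longrightarrow> c u > 0" "\<And>u. u \<in> ?S \<Longrightarrow> d u > 0" for c d
    using that by (intro continuous_intros continuous_on_compose2[OF f_cont]) (force intro: divide_pos_pos)+
  have gap_ratio: "gap (c u / d u) * d u = f (c u / d u) * d u - f 1 * d u - p * (c u - d u)"
    if "d u > 0" for c d :: "'a \<Rightarrow> real" and u
    using that by (simp add: gap_def field_simps)
  have gap_cont: "continuous_on ?S (\<lambda>u. gap (c u / d u) * d u)"
    and gap_integral: "(LINT u:?S|?M. gap (c u / d u) * d u)
       = (LINT u:?S|?M. f (c u / d u) * d u) - f 1 * (LINT u:?S|?M. d u)
          - p * ((LINT u:?S|?M. c u) - (LINT u:?S|?M. d u))"
    if cd: "continuous_on ?S c" "continuous_on ?S d"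
      "\<And>u. u \<in> ?S \<Longrightarrow> c u > 0" "\<And>u. u \<in> ?S \<Longrightarrow> d u > 0" for c d
  proof -
    have "continuous_on ?S (\<lambda>u. f (c u / d u) * d u - f 1 * d u - p * (c u - d u))"
      by (intro continuous_intros cont_f_ratio cd)
    then show "continuous_on ?S (\<lambda>u. gap (c u / d u) * d u)"
      using cd(4) by (subst continuous_on_cong[OF refl gap_ratio]) auto
    have "(LINT u:?S|?M. gap (c u / d u) * d u)
        = (LINT u:?S|?M. f (c u / d u) * d u - f 1 * d u - p * (c u - d u))"
      using cd(4) gap_ratio by (intro set_lebesgue_integral_cong) auto
    also have "\<dots> = (LINT u:?S|?M. f (c u / d u) * d u) - f 1 * (LINT u:?S|?M. d u)
          - p * ((LINT u:?S|?M. c u) - (LINT u:?S|?M. d u))"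
      using cont_f_ratio[OF cd, THEN continuous_set_integrable_sphere]
        cd(1,2)[THEN continuous_set_integrable_sphere]
      by (simp add: set_integral_diff)
    finally show "(LINT u:?S|?M. gap (c u / d u) * d u) = \<dots>" .
  qed
  let ?h = "\<lambda>u. gap (a u / b u) * b u + gap (b u / a u) * a u"
  have "?h u = 0"
  proof (rule continuous_nonneg_sphere_integral_eq_0[where f = ?h, OF _ _ _ u])
    show "continuous_on ?S ?h" by (intro continuous_intros gap_cont cont pos)
    show "0 \<le> ?h v" if "v \<in> ?S" for v
      using pos[OF that] by (intro add_nonneg_nonneg mult_nonneg_nonneg gap_nonneg) auto
    have "(LINT u:?S|?M. ?h u) = (LINT u:?S|?M. gap (a u / b u) * b u) + (LINT u:?S|?M. gap (b u / a u) * a u)"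
      by (intro set_integral_add continuous_set_integrable_sphere gap_cont cont pos)
    also have "\<dots> = 0"
      using gap_integral[OF cont pos] gap_integral[OF cont(2,1) pos(2,1)] ab ba
      by (simp add: algebra_simps)
    finally show "(LINT u:?S|?M. ?h u) = 0" .
  qed
  moreover have "gap (a u / b u) * b u \<ge> 0" "gap (b u / a u) * a u \<ge> 0"
    using pos[OF u] by (auto intro!: mult_nonneg_nonneg gap_nonneg)
  ultimately have "gap (a u / b u) * b u = 0" by linarith
  then have "a u / b u = 1" using pos[OF u] by (intro gap_eq_0) auto
  then show ?thesis using pos(2)[OF u] by simp
qed

section \<open>Star bodies and their dual mixed volumes\<close>

text \<open>On each ray the points of the body form a closed segment starting at 0, by compactness and
star-shapedness; so the supremum in the radial function is attained.\<close>

lemma star_body_mem_iff: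
  assumes L: "star_body (L :: (real ^ 'n) set)"
  shows "x \<in> L \<longleftrightarrow> x = 0 \<or> norm x \<le> radial_function L (x /\<^sub>R norm x)"
proof -
  have comp: "compact L" and star: "\<And>x. x \<in> L \<Longrightarrow> closed_segment 0 x \<subseteq> L"
    and rpos: "\<And>u. norm u = 1 \<Longrightarrow> radial_function L u > 0"
    using L by (auto simp: star_body_def)
  \<comment> \<open>Positivity of the radial function in one direction makes the body nonempty, so it contains 0.\<close>
  obtain e :: "real ^ 'n" where e: "norm e = 1" using vector_choose_size[of 1] by auto
  have "{r. r > 0 \<and> r *\<^sub>R e \<in> L} \<noteq> {}"
  proof
    assume "{r. r > 0 \<and> r *\<^sub>R e \<in> L} = {}"
    then have "radial_function L e = 0" unfolding radial_function_def by (simp only: cSup_singleton)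
    then show False using rpos[OF e] by simp
  qed
  then have zero: "0 \<in> L" using star by fastforce
  show ?thesis
  proof (cases "x = 0")
    case False
    define u where "u = x /\<^sub>R norm x"
    have u: "norm u = 1" "norm x *\<^sub>R u = x" using False by (auto simp: u_def)
    define T where "T = {r. 0 \<le> r \<and> r *\<^sub>R u \<in> L}"
    have T: "radial_function L u = Sup T"
      unfolding radial_function_def T_def using zero by (intro arg_cong[of _ _ Sup]) (auto simp: le_less)
    obtain B where B: "\<And>y. y \<in> L \<Longrightarrow> norm y \<le> B"
      using comp compact_imp_bounded bounded_iff by metis
    have bdd: "bdd_above T" using B u(1) by (force simp: T_def intro!: bdd_aboveI[of _ B])
    have "T = {0..} \<inter> (\<lambda>r. r *\<^sub>R u) -` L" by (auto simp: T_def)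
    moreover have "closed ({0..} \<inter> (\<lambda>r. r *\<^sub>R u) -` L)"
      by (intro continuous_closed_preimage continuous_intros closed_real_atLeast compact_imp_closed comp)
    ultimately have "closed T" by simp
    moreover have "T \<noteq> {}" using zero by (auto simp: T_def)
    ultimately have "Sup T \<in> T" using bdd by (intro closed_contains_Sup)
    then have top: "Sup T *\<^sub>R u \<in> L" by (simp add: T_def)
    have "x \<in> L" if "norm x \<le> Sup T"
    proof -
      have s: "Sup T > 0" using that False by (metis less_le_trans zero_less_norm_iff)
      have "x = (norm x / Sup T) *\<^sub>R (Sup T *\<^sub>R u)" using s u by simp
      then have "x \<in> closed_segment 0 (Sup T *\<^sub>R u)"
        unfolding closed_segment_def using that s
        by (auto intro!: exI[of _ "norm x / Sup T"])
      then show ?thesis using star[OF top] by blast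
    qed
    moreover have "norm x \<le> Sup T" if "x \<in> L"
      using that u(2) bdd by (intro cSup_upper) (auto simp: T_def)
    ultimately show ?thesis using False T by (auto simp: u_def)
  qed (simp add: zero)
qed

lemma star_body_eqI:
  assumes "star_body K" "star_body L"
    and "\<And>u. u \<in> sphere 0 1 \<Longrightarrow> radial_function K u = radial_function L u"
  shows "K = L"
proof (rule set_eqI)
  fix x show "x \<in> K \<longleftrightarrow> x \<in> L"
    using assms(3)[of "x /\<^sub>R norm x"]
    by (cases "x = 0") (auto simp: star_body_mem_iff[OF assms(1)] star_body_mem_iff[OF assms(2)])
qed

theorem corollary8p2:
  fixes K L Q :: "(real ^ 'n) set" and q :: real and \<phi> \<phi>\<^sub>q :: "real \<Rightarrow> real"
  assumes "star_body K" "star_body L" "star_body Q"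
    and "q \<noteq> 0"
    and "\<And>t. t > 0 \<Longrightarrow> \<phi> t > 0"
    and "\<And>t. t > 0 \<Longrightarrow> \<phi>\<^sub>q t = \<phi> (t powr (1 / q))"
    and "mono_on {0<..} \<phi> \<or> antimono_on {0<..} \<phi>"
    and "strictly_convex_on {0<..} \<phi>\<^sub>q \<or> strictly_concave_on {0<..} \<phi>\<^sub>q"
    and "(\<forall>M. star_body M \<longrightarrow>
            dual_Orlicz_mixed_volume q \<phi> K M Q / dual_mixed_volume q K Q =
            dual_Orlicz_mixed_volume q \<phi> L M Q / dual_mixed_volume q L Q) \<or>
         (\<forall>M. star_body M \<longrightarrow>
            dual_Orlicz_mixed_volume q \<phi> M K Q = dual_Orlicz_mixed_volume q \<phi> M L Q)"
  shows "K = L"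
proof (rule star_body_eqI[OF assms(1,2)])
  let ?M = "hausdorff_measure (CARD('n) - 1) :: (real ^ 'n) measure"
  let ?S = "sphere (0 :: real ^ 'n) 1"
  \<comment> \<open>The integrand of the dual mixed volume of \<open>B\<close> and \<open>Q\<close>; in a ratio of two such functions the
    weight of \<open>Q\<close> cancels, which leaves the \<open>q\<close>-th power of the ratio of the radial functions.\<close>
  define a where
    "a B u = radial_function B u powr q * radial_function Q u powr (real CARD('n) - q)"
    for B :: "(real ^ 'n) set" and u
  have rho_pos: "radial_function B u > 0" if "star_body B" "u \<in> ?S" for B u
    using that by (auto simp: star_body_def)
  have a_pos: "a B u > 0" if "star_body B" "u \<in> ?S" for B u
    using rho_pos[OF that] rho_pos[OF assms(3) that(2)] by (simp add: a_def)
  have a_cont: "continuous_on ?S (a B)" if "star_body B" for B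
  proof -
    have c: "continuous_on ?S (radial_function X)" "\<forall>u\<in>?S. radial_function X u \<noteq> 0"
      if "star_body X" for X
      using that by (force simp: star_body_def)+
    show ?thesis unfolding a_def
      by (intro continuous_intros c that assms(3))
  qed
  have V: "dual_mixed_volume q B Q = 1 / real CARD('n) * (LINT u:?S|?M. a B u)" for B
    by (simp add: dual_mixed_volume_def a_def)
  have W: "dual_Orlicz_mixed_volume q \<phi> B C Q
      = 1 / real CARD('n) * (LINT u:?S|?M. \<phi>\<^sub>q (a C u / a B u) * a B u)"
    if BC: "star_body B" "star_body C" for B C
  proof -
    have "(LINT u:?S|?M. \<phi> (radial_function C u / radial_function B u) *
        radial_function B u powr q * radial_function Q u powr (real CARD('n) - q))
      = (LINT u:?S|?M. \<phi>\<^sub>q (a C u / a B u) * a B u)"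
    proof (intro set_lebesgue_integral_cong allI impI)
      fix u assume u: "u \<in> ?S"
      note pos = rho_pos[OF BC(1) u] rho_pos[OF BC(2) u] rho_pos[OF assms(3) u]
      have "a C u / a B u = (radial_function C u / radial_function B u) powr q"
        using pos by (simp add: a_def powr_divide)
      then have "\<phi>\<^sub>q (a C u / a B u) = \<phi> (radial_function C u / radial_function B u)"
        using pos assms(4) by (simp add: assms(6) powr_powr)
      then show "\<phi> (radial_function C u / radial_function B u) *
        radial_function B u powr q * radial_function Q u powr (real CARD('n) - q)
        = \<phi>\<^sub>q (a C u / a B u) * a B u"
        by (simp add: a_def)
    qed simp
    then show ?thesis by (simp add: dual_Orlicz_mixed_volume_def)
  qed
  have diag: "dual_Orlicz_mixed_volume q \<phi> B B Q = \<phi>\<^sub>q 1 * dual_mixed_volume q B Q"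
    if B: "star_body B" for B
  proof -
    have "(LINT u:?S|?M. \<phi>\<^sub>q (a B u / a B u) * a B u) = (LINT u:?S|?M. \<phi>\<^sub>q 1 * a B u)"
      using a_pos[OF B] by (intro set_lebesgue_integral_cong) (auto simp: less_imp_neq[symmetric])
    then show ?thesis by (simp add: W[OF B B] V)
  qed
  have V_neq_0: "dual_mixed_volume q B Q \<noteq> 0" if B: "star_body B" for B
  proof
    assume "dual_mixed_volume q B Q = 0"
    then have zero: "(LINT u:?S|?M. a B u) = 0" by (simp add: V)
    obtain e :: "real ^ 'n" where "norm e = 1" using vector_choose_size[of 1] by auto
    then show False
      using continuous_nonneg_sphere_integral_eq_0[OF a_cont[OF B], of e] zero a_pos[OF B]
      by (force simp: less_imp_le)
  qed
  \<comment> \<open>Both alternatives, tested at \<open>M = K\<close> and \<open>M = L\<close>, say the same.\<close>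
  have "dual_Orlicz_mixed_volume q \<phi> L K Q = \<phi>\<^sub>q 1 * dual_mixed_volume q L Q \<and>
        dual_Orlicz_mixed_volume q \<phi> K L Q = \<phi>\<^sub>q 1 * dual_mixed_volume q K Q"
    using assms(9)
  proof
    assume H: "\<forall>M. star_body M \<longrightarrow>
            dual_Orlicz_mixed_volume q \<phi> K M Q / dual_mixed_volume q K Q =
            dual_Orlicz_mixed_volume q \<phi> L M Q / dual_mixed_volume q L Q"
    from H assms(1,2) diag V_neq_0 show ?thesis
      by (metis nonzero_mult_div_cancel_right nonzero_eq_divide_eq)
  next
    assume "\<forall>M. star_body M \<longrightarrow>
            dual_Orlicz_mixed_volume q \<phi> M K Q = dual_Orlicz_mixed_volume q \<phi> M L Q"
    with assms(1,2) diag show ?thesis by metis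
  qed
  then have eqs:
    "(LINT u:?S|?M. \<phi>\<^sub>q (a K u / a L u) * a L u) = \<phi>\<^sub>q 1 * (LINT u:?S|?M. a L u)"
    "(LINT u:?S|?M. \<phi>\<^sub>q (a L u / a K u) * a K u) = \<phi>\<^sub>q 1 * (LINT u:?S|?M. a K u)"
    unfolding V W[OF assms(1,2)] W[OF assms(2,1)] by simp_all
  fix u assume u: "u \<in> ?S"
  have "a K u = a L u"
    using assms(8)
  proof
    assume "strictly_convex_on {0<..} \<phi>\<^sub>q"
    then show ?thesis
      by (rule f_divergence_equality[OF _ a_cont a_cont a_pos a_pos _ _ u])
        (simp_all add: assms(1,2) eqs del: One_nat_def)
  next
    have uminus_integral: "(LINT u:?S|?M. - (h u)) = - (LINT u:?S|?M. h u)" for h :: "real ^ 'n \<Rightarrow> real"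
      using set_integral_mult_right[of ?M ?S "-1" h] by simp
    assume "strictly_concave_on {0<..} \<phi>\<^sub>q"
    then have "strictly_convex_on {0<..} (\<lambda>t. - \<phi>\<^sub>q t)" by (simp add: strictly_concave_on_def)
    then show ?thesis
      by (rule f_divergence_equality[OF _ a_cont a_cont a_pos a_pos _ _ u])
        (simp_all add: assms(1,2) eqs uminus_integral del: One_nat_def)
  qed
  then have "radial_function K u powr q = radial_function L u powr q"
    using rho_pos[OF assms(3) u] by (simp add: a_def)
  then show "radial_function K u = radial_function L u"
    using rho_pos[OF assms(1) u] rho_pos[OF assms(2) u] assms(4)
    by (metis less_imp_le powr_powr powr_one right_inverse)
qed

end
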